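(* Let $N=(G=(V,E),\sigma,u,s)$ be a skew-symmetric network. Then the maximum value of an IS-flow in $N$ equals the minimum capacity $u(\mathcal B)$ over all odd $s$-barriers $\mathcal B$ for $(G,u)$.
   Context: A skew-symmetric graph is a finite directed graph $G=(V,E)$ (parallel arcs allowed) with a map $\sigma$ of $V\cup E$ onto itself such that $\sigma(x)\ne x$, $\sigma(\sigma(x))=x$ for all $x$, $\sigma(V)=V$, and for each arc $a$ from $v$ to $w$, $\sigma(a)$ is an arc from $\sigma(w)$ to $\sigma(v)$. A function on $E$ is symmetric if it takes equal values on $a$ and $\sigma(a)$. A skew-symmetric network is $N=(G,\sigma,u,s)$ with $u:E\to\mathbb Z_{\ge0}$ symmetric and source $s$; $s'=\sigma(s)$. A flow is $f:E\to\mathbb R_{\ge0}$ with $f\le u$ and flow conservation at each node other than $s,s'$; its value is the net outflow at $s$. An IS-flow is an integer-valued symmetric flow. For $X,Y\subseteq V$, $u(X,Y)$ denotes the total capacity of arcs from $X$ to $Y$. An odd $s$-barrier is a tuple $\mathcal B=(A;X_1,\dots,X_k)$ ($k\ge0$) such that: (O1) $A,X_1,\dots,X_k$ are pairwise disjoint subsets of $V$ and $s\in A$; (O2) $A\cap\sigma(A)=\emptyset$; (O3) $\sigma(X_i)=X_i$ for each $i$; (O4) $u(A,X_i)$ is odd for each $i$; (O5) for $i\neq j$ no arc of positive capacity connects $X_i$ and $X_j$ (in either direction); (O6) with $M:=V\setminus(A\cup\sigma(A)\cup X_1\cup\dots\cup X_k)$, no arc of positive capacity connects $X_i$ and $M$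 for any $i$. Its capacity is $u(\mathcal B):=u(A,V\setminus A)-k$. *)

theory Defs
  imports Complex_Main
begin

text \<open>A skew-symmetric graph: finite vertex set V, finite arc set E (parallel arcs allowed,
arcs are abstract objects with tail/head), and the skew-symmetry \<sigma> given by its restrictions
sv to vertices and se to arcs.\<close>

definition skew_symmetric_graph ::
  "'v set \<Rightarrow> 'e set \<Rightarrow> ('e \<Rightarrow> 'v) \<Rightarrow> ('e \<Rightarrow> 'v) \<Rightarrow> ('v \<Rightarrow> 'v) \<Rightarrow> ('e \<Rightarrow> 'e) \<Rightarrow> bool" where
  "skew_symmetric_graph V E tail head sv se \<longleftrightarrow>
     finite V \<and> finite E \<and>
     (\<forall>a\<in>E. tail a \<in> V \<and> head a \<in> V) \<and>
     (\<forall>v\<in>V. sv v \<in> V \<and> sv v \<noteq> v \<and> sv (sv v) = v) \<and>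
     (\<forall>a\<in>E. se a \<in> E \<and> se a \<noteq> a \<and> se (se a) = a) \<and>
     (\<forall>a\<in>E. tail (se a) = sv (head a) \<and> head (se a) = sv (tail a))"

definition skew_symmetric_network ::
  "'v set \<Rightarrow> 'e set \<Rightarrow> ('e \<Rightarrow> 'v) \<Rightarrow> ('e \<Rightarrow> 'v) \<Rightarrow> ('v \<Rightarrow> 'v) \<Rightarrow> ('e \<Rightarrow> 'e)
    \<Rightarrow> ('e \<Rightarrow> nat) \<Rightarrow> 'v \<Rightarrow> bool" where
  "skew_symmetric_network V E tail head sv se u s \<longleftrightarrow>
     skew_symmetric_graph V E tail head sv se \<and> (\<forall>a\<in>E. u (se a) = u a) \<and> s \<in> V"

definition outflow :: "'e set \<Rightarrow> ('e \<Rightarrow> 'v) \<Rightarrow> ('e \<Rightarrow> real) \<Rightarrow> 'v \<Rightarrow> real" where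
  "outflow E tail f v = (\<Sum>a\<in>{a\<in>E. tail a = v}. f a)"

definition inflow :: "'e set \<Rightarrow> ('e \<Rightarrow> 'v) \<Rightarrow> ('e \<Rightarrow> real) \<Rightarrow> 'v \<Rightarrow> real" where
  "inflow E head f v = (\<Sum>a\<in>{a\<in>E. head a = v}. f a)"

definition is_flow ::
  "'v set \<Rightarrow> 'e set \<Rightarrow> ('e \<Rightarrow> 'v) \<Rightarrow> ('e \<Rightarrow> 'v) \<Rightarrow> ('v \<Rightarrow> 'v) \<Rightarrow> ('e \<Rightarrow> nat) \<Rightarrow> 'v
    \<Rightarrow> ('e \<Rightarrow> real) \<Rightarrow> bool" where
  "is_flow V E tail head sv u s f \<longleftrightarrow>
     (\<forall>a\<in>E. 0 \<le> f a \<and> f a \<le> real (u a)) \<and>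
     (\<forall>v\<in>V - {s, sv s}. inflow E head f v = outflow E tail f v)"

definition flow_value :: "'e set \<Rightarrow> ('e \<Rightarrow> 'v) \<Rightarrow> ('e \<Rightarrow> 'v) \<Rightarrow> 'v \<Rightarrow> ('e \<Rightarrow> real) \<Rightarrow> real" where
  "flow_value E tail head s f = outflow E tail f s - inflow E head f s"

definition is_IS_flow ::
  "'v set \<Rightarrow> 'e set \<Rightarrow> ('e \<Rightarrow> 'v) \<Rightarrow> ('e \<Rightarrow> 'v) \<Rightarrow> ('v \<Rightarrow> 'v) \<Rightarrow> ('e \<Rightarrow> 'e)
    \<Rightarrow> ('e \<Rightarrow> nat) \<Rightarrow> 'v \<Rightarrow> ('e \<Rightarrow> real) \<Rightarrow> bool" where
  "is_IS_flow V E tail head sv se u s f \<longleftrightarrow>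
     is_flow V E tail head sv u s f \<and> (\<forall>a\<in>E. f a \<in> \<int> \<and> f (se a) = f a)"

definition cap_between :: "'e set \<Rightarrow> ('e \<Rightarrow> 'v) \<Rightarrow> ('e \<Rightarrow> 'v) \<Rightarrow> ('e \<Rightarrow> nat) \<Rightarrow> 'v set \<Rightarrow> 'v set \<Rightarrow> nat" where
  "cap_between E tail head u X Y = (\<Sum>a\<in>{a\<in>E. tail a \<in> X \<and> head a \<in> Y}. u a)"

definition no_pos_arc :: "'e set \<Rightarrow> ('e \<Rightarrow> 'v) \<Rightarrow> ('e \<Rightarrow> 'v) \<Rightarrow> ('e \<Rightarrow> nat) \<Rightarrow> 'v set \<Rightarrow> 'v set \<Rightarrow> bool" where
  "no_pos_arc E tail head u X Y \<longleftrightarrow>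
     (\<forall>a\<in>E. 0 < u a \<longrightarrow> \<not> (tail a \<in> X \<and> head a \<in> Y) \<and> \<not> (tail a \<in> Y \<and> head a \<in> X))"

definition odd_barrier ::
  "'v set \<Rightarrow> 'e set \<Rightarrow> ('e \<Rightarrow> 'v) \<Rightarrow> ('e \<Rightarrow> 'v) \<Rightarrow> ('v \<Rightarrow> 'v) \<Rightarrow> ('e \<Rightarrow> nat) \<Rightarrow> 'v
    \<Rightarrow> 'v set \<Rightarrow> 'v set list \<Rightarrow> bool" where
  "odd_barrier V E tail head sv u s A Xs \<longleftrightarrow>
     (let k = length Xs;
          M = V - (A \<union> sv ` A \<union> \<Union>(set Xs)) in
      A \<subseteq> V \<and> (\<forall>i<k. Xs ! i \<subseteq> V) \<and> s \<in> A \<and>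
      (\<forall>i<k. A \<inter> Xs ! i = {}) \<and>
      (\<forall>i<k. \<forall>j<k. i \<noteq> j \<longrightarrow> Xs ! i \<inter> Xs ! j = {}) \<and>
      A \<inter> sv ` A = {} \<and>
      (\<forall>i<k. sv ` (Xs ! i) = Xs ! i) \<and>
      (\<forall>i<k. odd (cap_between E tail head u A (Xs ! i))) \<and>
      (\<forall>i<k. \<forall>j<k. i \<noteq> j \<longrightarrow> no_pos_arc E tail head u (Xs ! i) (Xs ! j)) \<and>
      (\<forall>i<k. no_pos_arc E tail head u (Xs ! i) M))"

definition barrier_capacity ::
  "'v set \<Rightarrow> 'e set \<Rightarrow> ('e \<Rightarrow> 'v) \<Rightarrow> ('e \<Rightarrow> 'v) \<Rightarrow> ('e \<Rightarrow> nat) \<Rightarrow> 'v set \<Rightarrow> 'v set list \<Rightarrow> int" where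
  "barrier_capacity V E tail head u A Xs = int (cap_between E tail head u A (V - A)) - int (length Xs)"

end

theory Submission
  imports Defs
begin

text \<open>
Splitting arcs into unit arcs, a symmetric integer flow becomes a set of unit arcs closed under the
symmetry. A walk in the residual graph from the source to its mate that never uses an arc twice, nor
together with its mate, can be augmented along simultaneously with its mirror image, which raises
the value by two. If no such regular walk exists, a barrier of the residual graph does: grow the set
of sources along an arc \<open>e\<close>; if this creates a regular walk from the head \<open>v\<close> of \<open>e\<close> to the mate of
\<open>v\<close>, shrink this blossom and recurse. A barrier of the residual graph has exactly one residual arc
into each component, so the flow misses the cut capacity by the number of components.

That no flow does better is a parity argument: conservation and symmetry make the flow between
\<open>A\<close> and a self-symmetric component (counted in both directions) even, so an odd capacity cannot be
used up completely.
\<close>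

section \<open>Regular reachability in skew-symmetric graphs\<close>

primrec walk :: "'e set \<Rightarrow> ('e \<Rightarrow> 'v) \<Rightarrow> ('e \<Rightarrow> 'v) \<Rightarrow> 'v \<Rightarrow> 'e list \<Rightarrow> 'v \<Rightarrow> bool" where
  "walk E t h x [] y \<longleftrightarrow> x = y"
| "walk E t h x (a # p) y \<longleftrightarrow> a \<in> E \<and> t a = x \<and> walk E t h (h a) p y"

lemma walk_append: "walk E t h x (p @ q) z \<longleftrightarrow> (\<exists>y. walk E t h x p y \<and> walk E t h y q z)"
  by (induction p arbitrary: x) auto

lemma walk_subset: "walk E t h x p y \<Longrightarrow> set p \<subseteq> E"
  by (induction p arbitrary: x) auto

lemma walk_mono: "walk E t h x p y \<Longrightarrow> set p \<subseteq> E' \<Longrightarrow> walk E' t h x p y"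
  by (induction p arbitrary: x) auto

lemma walk_split:
  assumes "walk E t h x p y" "z \<in> t ` set p \<union> h ` set p"
  obtains q r where "p = q @ r" "walk E t h x q z" "walk E t h z r y"
proof -
  from assms obtain a where a: "a \<in> set p" "z = t a \<or> z = h a" by auto
  then obtain q r where p: "p = q @ a # r" by (meson split_list)
  with assms(1) have w: "walk E t h x q (t a)" "a \<in> E" "walk E t h (h a) r y"
    by (auto simp: walk_append)
  show thesis
  proof (cases "z = t a")
    case True
    with w p show ?thesis by (intro that[of q "a # r"]) auto
  next
    case False
    with a have "z = h a" by simp
    with w p show ?thesis by (intro that[of "q @ [a]" r]) (auto simp: walk_append)
  qed
qed

definition regular :: "('e \<Rightarrow> 'e) \<Rightarrow> 'e list \<Rightarrow> bool" where
  "regular \<rho> p \<longleftrightarrow> distinct p \<and> (\<forall>a\<in>set p. \<rho> a \<notin> set p)"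

text \<open>A set of sources replaces the single source because the induction on arcs enlarges it.
  The walk may start at one source and end at the mate of another.\<close>

definition regular_connected ::
  "'e set \<Rightarrow> ('e \<Rightarrow> 'v) \<Rightarrow> ('e \<Rightarrow> 'v) \<Rightarrow> ('v \<Rightarrow> 'v) \<Rightarrow> ('e \<Rightarrow> 'e) \<Rightarrow> 'v set \<Rightarrow> bool" where
  "regular_connected E t h \<sigma> \<rho> S \<longleftrightarrow>
     (\<exists>x\<in>S. \<exists>y\<in>S. \<exists>p. walk E t h x p (\<sigma> y) \<and> regular \<rho> p)"

text \<open>A barrier is encoded by its set \<open>A\<close> and a labelling \<open>l\<close>: \<open>l x = Some b\<close> says that \<open>x\<close> lies in
the component whose unique arc entering from \<open>A\<close> is \<open>b\<close>.\<close>

definition regular_barrier ::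
  "'e set \<Rightarrow> ('e \<Rightarrow> 'v) \<Rightarrow> ('e \<Rightarrow> 'v) \<Rightarrow> ('v \<Rightarrow> 'v) \<Rightarrow> 'v set \<Rightarrow> 'v set \<Rightarrow> ('v \<Rightarrow> 'e option) \<Rightarrow> bool" where
  "regular_barrier E t h \<sigma> S A l \<longleftrightarrow>
     S \<subseteq> A \<and> (\<forall>x\<in>A. \<sigma> x \<notin> A) \<and>
     (\<forall>x b. l x = Some b \<longrightarrow>
        x \<notin> A \<and> \<sigma> x \<notin> A \<and> l (\<sigma> x) = Some b \<and> b \<in> E \<and> t b \<in> A \<and> l (h b) = Some b) \<and>
     (\<forall>a\<in>E. t a \<in> A \<longrightarrow> h a \<in> A \<or> l (h a) = Some a) \<and>
     (\<forall>a\<in>E. t a \<notin> A \<and> \<sigma> (t a) \<notin> A \<and> h a \<notin> A \<and> \<sigma> (h a) \<notin> A \<longrightarrow> l (t a) = l (h a))"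

lemma regular_barrierD:
  assumes "regular_barrier E t h \<sigma> S A l"
  shows "S \<subseteq> A" and "x \<in> A \<Longrightarrow> \<sigma> x \<notin> A"
    and "l x = Some b \<Longrightarrow>
        x \<notin> A \<and> \<sigma> x \<notin> A \<and> l (\<sigma> x) = Some b \<and> b \<in> E \<and> t b \<in> A \<and> l (h b) = Some b"
    and "a \<in> E \<Longrightarrow> t a \<in> A \<Longrightarrow> h a \<in> A \<or> l (h a) = Some a"
    and "a \<in> E \<Longrightarrow> t a \<notin> A \<Longrightarrow> \<sigma> (t a) \<notin> A \<Longrightarrow> h a \<notin> A \<Longrightarrow> \<sigma> (h a) \<notin> A \<Longrightarrow> l (t a) = l (h a)"
  using assms unfolding regular_barrier_def by blast+

text \<open>\<open>\<sigma>\<close> is an involution of the whole type but has to move only the ends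
  of arcs, so it may be the identity where a given symmetry is unspecified.\<close>

locale skew_digraph =
  fixes E :: "'e set" and t h :: "'e \<Rightarrow> 'v" and \<sigma> :: "'v \<Rightarrow> 'v" and \<rho> :: "'e \<Rightarrow> 'e"
  assumes finite_arcs: "finite E"
    and mate_mate [simp]: "\<sigma> (\<sigma> x) = x"
    and arc_mate_in [simp]: "a \<in> E \<Longrightarrow> \<rho> a \<in> E"
    and arc_mate_neq: "a \<in> E \<Longrightarrow> \<rho> a \<noteq> a"
    and arc_mate_mate [simp]: "a \<in> E \<Longrightarrow> \<rho> (\<rho> a) = a"
    and tail_mate [simp]: "a \<in> E \<Longrightarrow> t (\<rho> a) = \<sigma> (h a)"
    and head_mate [simp]: "a \<in> E \<Longrightarrow> h (\<rho> a) = \<sigma> (t a)"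
    and tail_not_fixed: "a \<in> E \<Longrightarrow> \<sigma> (t a) \<noteq> t a"
begin

lemma head_not_fixed: "a \<in> E \<Longrightarrow> \<sigma> (h a) \<noteq> h a"
  using tail_not_fixed[of "\<rho> a"] by auto

lemma walk_mate: "walk E t h x p y \<Longrightarrow> walk E t h (\<sigma> y) (rev (map \<rho> p)) (\<sigma> x)"
  by (induction p arbitrary: x) (auto simp: walk_append)

lemma regular_mate:
  assumes "regular \<rho> p" "set p \<subseteq> E"
  shows "regular \<rho> (rev (map \<rho> p))"
proof -
  have "inj_on \<rho> (set p)"
    using assms(2) by (intro inj_on_inverseI[of _ \<rho>]) auto
  moreover have "\<rho> (\<rho> a) \<notin> \<rho> ` set p" if "a \<in> set p" for a
    using that assms by (auto simp: regular_def subset_iff)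
  ultimately show ?thesis
    using assms by (auto simp: regular_def distinct_map)
qed

end

section \<open>Trimming a blossom and lifting walks and barriers back\<close>

locale blossom = skew_digraph +
  fixes e :: 'a and p :: "'a list"
  assumes e_in: "e \<in> E"
    and walk_p: "walk (E - {e, \<rho> e}) t h (h e) p (\<sigma> (h e))"
    and regular_p: "regular \<rho> p"
begin

definition B where "B = (t ` set p \<union> h ` set p) \<union> \<sigma> ` (t ` set p \<union> h ` set p)"

text \<open>Trimming the blossom \<open>B\<close> with base arc \<open>e\<close>: all other arcs leaving \<open>B\<close> now leave from the head
of \<open>e\<close>, all other arcs entering \<open>B\<close> now enter its mate, so a walk through \<open>B\<close> must use \<open>e\<close> or its
mate.\<close>

definition "E1 = {a \<in> E. t a \<notin> B \<or> h a \<notin> B}"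
definition "t1 a = (if a \<noteq> \<rho> e \<and> t a \<in> B then h e else t a)"
definition "h1 a = (if a \<noteq> e \<and> h a \<in> B then \<sigma> (h e) else h a)"

lemma p_subset: "set p \<subseteq> E"
  using walk_subset[OF walk_p] by auto

lemma p_nonempty: "p \<noteq> []"
  using walk_p head_not_fixed[OF e_in] by auto

lemma B_cases:
  assumes "b \<in> B"
  obtains "b \<in> t ` set p \<union> h ` set p" | "\<sigma> b \<in> t ` set p \<union> h ` set p"
proof -
  have "\<sigma> b \<in> X" if "b \<in> \<sigma> ` X" for X
    using that by auto
  with assms that show thesis
    unfolding B_def by blast
qed

lemma mate_in_B [simp]: "\<sigma> x \<in> B \<longleftrightarrow> x \<in> B"
proof -
  have "\<sigma> x \<in> X \<union> \<sigma> ` X \<longleftrightarrow> x \<in> X \<union> \<sigma> ` X" for X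
    using mate_mate by (metis Un_iff imageE imageI)
  then show ?thesis unfolding B_def .
qed

lemma base_in_B [simp]: "h e \<in> B"
proof -
  have "h e \<in> t ` set p" using walk_p p_nonempty by (cases p) auto
  then show ?thesis by (auto simp: B_def)
qed

lemma base_not_fixed [simp]: "\<sigma> (h e) \<noteq> h e" "h e \<noteq> \<sigma> (h e)"
  using head_not_fixed[OF e_in] by auto

text \<open>Every end of an arc of \<open>p\<close> or of its mate lies in \<open>B\<close>, so
  trimming deletes these arcs. Hence the induction descends, and walks inside the blossom share no
  arc with trimmed walks.\<close>

lemma p_disjoint_E1: "set p \<inter> E1 = {}" "\<rho> ` set p \<inter> E1 = {}"
proof -
  have "a \<in> E" "t a \<in> B" "h a \<in> B" if "a \<in> set p" for a
    using that p_subset by (auto simp: B_def)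
  then show "set p \<inter> E1 = {}" "\<rho> ` set p \<inter> E1 = {}"
    by (fastforce simp: E1_def)+
qed

lemma trimmed_skew: "skew_digraph E1 t1 h1 \<sigma> \<rho>"
proof
  show "finite E1" using finite_arcs by (simp add: E1_def)
next
  fix a assume a: "a \<in> E1"
  then have aE: "a \<in> E" by (simp add: E1_def)
  \<comment> \<open>\<open>\<rho>\<close> exchanges \<open>e\<close> with \<open>\<rho> e\<close>,
    and with them the exceptions made in \<open>h1\<close> and \<open>t1\<close>.\<close>
  have eq: "\<rho> a = \<rho> e \<longleftrightarrow> a = e" "\<rho> a = e \<longleftrightarrow> a = \<rho> e"
    using aE e_in arc_mate_mate by metis+
  show "\<rho> a \<in> E1" using a by (auto simp: E1_def)
  show "\<rho> a \<noteq> a" "\<rho> (\<rho> a) = a" using aE arc_mate_neq by auto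
  show "t1 (\<rho> a) = \<sigma> (h1 a)" "h1 (\<rho> a) = \<sigma> (t1 a)"
    using aE by (auto simp: t1_def h1_def eq)
  show "\<sigma> (t1 a) \<noteq> t1 a"
    using aE tail_not_fixed by (auto simp: t1_def)
qed simp

lemma card_E1: "card E1 < card E"
proof (rule psubset_card_mono[OF finite_arcs])
  obtain a where "a \<in> set p" using p_nonempty by (cases p) auto
  with p_subset p_disjoint_E1 have "a \<in> E - E1" by auto
  then show "E1 \<subset> E" by (auto simp: E1_def)
qed

text \<open>If \<open>b\<close> lies on \<open>p\<close>, an initial segment of \<open>p\<close>
  serves; if the mate of \<open>b\<close> does, reverse and reflect the final segment of
  \<open>p\<close> that starts there.\<close>

lemma walk_in_blossom:
  assumes "b \<in> B"
  obtains q where "walk E t h (h e) q b" "regular \<rho> q" "set q \<inter> E1 = {}"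
proof -
  have wp: "walk E t h (h e) p (\<sigma> (h e))"
    using walk_p p_subset walk_mono by metis
  have reg: "regular \<rho> q" "regular \<rho> r" if "p = q @ r" for q r
    using regular_p that by (auto simp: regular_def)
  from assms consider "b \<in> t ` set p \<union> h ` set p" | "\<sigma> b \<in> t ` set p \<union> h ` set p"
    by (rule B_cases)
  then show thesis
  proof cases
    case 1
    with walk_split[OF wp] obtain q r where "p = q @ r" "walk E t h (h e) q b" by metis
    with reg p_disjoint_E1 show ?thesis by (intro that[of q]) auto
  next
    case 2
    with walk_split[OF wp] obtain q r where *: "p = q @ r" "walk E t h (\<sigma> b) r (\<sigma> (h e))" by metis
    have "walk E t h (h e) (rev (map \<rho> r)) b"
      using walk_mate[OF *(2)] by simp
    moreover have "regular \<rho> (rev (map \<rho> r))"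
      using reg[OF *(1)] p_subset *(1) by (intro regular_mate) auto
    ultimately show ?thesis
      using p_disjoint_E1 *(1) by (intro that[of "rev (map \<rho> r)"]) auto
  qed
qed

text \<open>Only \<open>\<rho> e\<close> can leave the mate of the base: every other arc with tail
  in \<open>B\<close> was moved to start at the base.\<close>

lemma no_trimmed_walk_from_mate:
  assumes "walk E1 t1 h1 (\<sigma> (h e)) q y" "\<rho> e \<notin> set q"
  shows "y = \<sigma> (h e)"
proof (cases q)
  case (Cons a r)
  then have "t1 a = \<sigma> (h e)" "a \<noteq> \<rho> e" using assms by auto
  then show ?thesis
    using base_in_B base_not_fixed mate_in_B unfolding t1_def by metis
qed (use assms in simp)

text \<open>Such a walk never enters \<open>B\<close>: an entering arc would lead to the mate of the
  base, a dead end without \<open>\<rho> e\<close>. Off \<open>B\<close> trimming changes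
  nothing.\<close>

lemma walk_untrim_avoiding:
  assumes "walk E1 t1 h1 x q y" "e \<notin> set q" "\<rho> e \<notin> set q" "x \<notin> B" "y \<notin> B"
  shows "walk E t h x q y"
  using assms
proof (induction q arbitrary: x)
  case (Cons a q)
  have ta: "t a = x" using Cons.prems by (auto simp: t1_def split: if_splits)
  have "h a \<notin> B"
  proof
    assume "h a \<in> B"
    then have "h1 a = \<sigma> (h e)" using Cons.prems by (auto simp: h1_def)
    then have "walk E1 t1 h1 (\<sigma> (h e)) q y" using Cons.prems by simp
    then have "y = \<sigma> (h e)" using no_trimmed_walk_from_mate Cons.prems by auto
    with Cons.prems show False by simp
  qed
  then have "h1 a = h a" by (simp add: h1_def)
  with Cons ta \<open>h a \<notin> B\<close> show ?case by (auto simp: E1_def)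
qed simp

text \<open>After \<open>e\<close> the walk stands at the base and leaves by an arc \<open>c\<close>
  whose original tail is some vertex of \<open>B\<close>. A regular walk inside the blossom from the
  base to that vertex fills the gap; the parts before \<open>e\<close> and after \<open>c\<close>
  stay off \<open>B\<close>.\<close>

lemma walk_untrim_base:
  assumes w: "walk E1 t1 h1 x q y" and reg: "regular \<rho> q" and "e \<in> set q"
    and "x \<notin> B" "y \<notin> B" "t e \<notin> B"
  shows "\<exists>q'. walk E t h x q' y \<and> regular \<rho> q'"
proof -
  from \<open>e \<in> set q\<close> obtain q1 q2 where q: "q = q1 @ e # q2" by (meson split_list)
  have e1: "t1 e = t e" "h1 e = h e" using \<open>t e \<notin> B\<close> by (auto simp: t1_def h1_def)
  have avoid: "e \<notin> set q1" "e \<notin> set q2" "\<rho> e \<notin> set q1" "\<rho> e \<notin> set q2"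
    using reg by (auto simp: q regular_def)
  have w1: "walk E1 t1 h1 x q1 (t e)" and w2: "walk E1 t1 h1 (h e) q2 y"
    using w e1 by (auto simp: q walk_append)
  have "q2 \<noteq> []" using w2 \<open>y \<notin> B\<close> by auto
  then obtain c q3 where q2: "q2 = c # q3" by (cases q2) auto
  have c: "c \<in> E1" "t1 c = h e" "walk E1 t1 h1 (h1 c) q3 y" "c \<noteq> e" "c \<noteq> \<rho> e"
    using w2 avoid by (auto simp: q2)
  have tc: "t c \<in> B" using c by (auto simp: t1_def split: if_splits)
  with c have hc: "h c \<notin> B" "c \<in> E" by (auto simp: E1_def)
  then have "h1 c = h c" by (simp add: h1_def)
  have wq1: "walk E t h x q1 (t e)"
    using walk_untrim_avoiding[OF w1] avoid assms by auto
  have wq3: "walk E t h (h c) q3 y"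
    using walk_untrim_avoiding[OF c(3)] avoid assms hc \<open>h1 c = h c\<close> by (auto simp: q2)
  obtain r where r: "walk E t h (h e) r (t c)" "regular \<rho> r" "set r \<inter> E1 = {}"
    using walk_in_blossom[OF tc] by blast
  have sub: "set q \<subseteq> E1" using walk_subset[OF w] .
  have rE: "set r \<subseteq> E" using walk_subset[OF r(1)] .
  \<comment> \<open>\<open>r\<close> uses only deleted arcs, while \<open>E1\<close> contains
    \<open>q\<close> and is closed under \<open>\<rho>\<close>, so the splice remains
    regular.\<close>
  have mates: "\<rho> a \<notin> set r" if "a \<in> set q" for a
    using that sub r(3) skew_digraph.arc_mate_in[OF trimmed_skew] by blast
  have mates': "\<rho> a \<notin> set q" if "a \<in> set r" for a
    using mates[of "\<rho> a"] that rE by auto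
  have "walk E t h x (q1 @ e # r @ c # q3) y"
    using wq1 wq3 r(1) e_in hc by (auto simp: walk_append)
  moreover have "regular \<rho> (q1 @ e # r @ c # q3)"
    using reg r(2) mates mates' sub r(3) unfolding q q2 regular_def by auto
  ultimately show ?thesis by blast
qed

text \<open>Regularity allows at most one of \<open>e\<close> and \<open>\<rho> e\<close>;
  reflection turns a walk through \<open>\<rho> e\<close> into one through \<open>e\<close>.\<close>

lemma regular_connected_untrim:
  assumes "regular_connected E1 t1 h1 \<sigma> \<rho> S" "S \<inter> B = {}" "t e \<in> S"
  shows "regular_connected E t h \<sigma> \<rho> S"
proof -
  from assms obtain x y q where xy: "x \<in> S" "y \<in> S" and w: "walk E1 t1 h1 x q (\<sigma> y)"
    and reg: "regular \<rho> q" by (auto simp: regular_connected_def)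
  have nB: "x \<notin> B" "y \<notin> B" "t e \<notin> B" using xy assms by auto
  have qE: "set q \<subseteq> E1" using walk_subset[OF w] .
  consider "e \<in> set q" | "\<rho> e \<in> set q" | "e \<notin> set q" "\<rho> e \<notin> set q" by blast
  then show ?thesis
  proof cases
    case 1
    from walk_untrim_base[OF w reg 1] nB xy show ?thesis
      unfolding regular_connected_def by auto
  next
    case 2
    have w': "walk E1 t1 h1 y (rev (map \<rho> q)) (\<sigma> x)"
      using skew_digraph.walk_mate[OF trimmed_skew w] by simp
    have "e \<in> set (rev (map \<rho> q))" using 2 e_in by (force simp: image_iff)
    from walk_untrim_base[OF w' _ this] skew_digraph.regular_mate[OF trimmed_skew reg qE] nB xy
    show ?thesis unfolding regular_connected_def by auto
  next
    case 3
    with walk_untrim_avoiding[OF w] nB reg xy show ?thesis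
      unfolding regular_connected_def by auto
  qed
qed

text \<open>The arc \<open>e\<close> starts in \<open>A\<close>, so its head lies in
  \<open>A\<close> or in the component of \<open>e\<close>. In both cases \<open>B\<close> can be
  taken out of \<open>A\<close> and become part of a single component with entering arc
  \<open>e\<close>.\<close>

lemma regular_barrier_untrim:
  assumes bar: "regular_barrier E1 t1 h1 \<sigma> S A l" and SB: "S \<inter> B = {}" and teS: "t e \<in> S"
  shows "\<exists>A' l'. regular_barrier E t h \<sigma> S A' l'"
proof -
  \<comment> \<open>the component entered by \<open>e\<close> absorbs \<open>B\<close> and every component entered from \<open>B\<close>\<close>
  define C where "C x \<longleftrightarrow> x \<in> B \<or> (\<exists>a. l x = Some a \<and> (a = e \<or> t a \<in> B))" for x
  define A' where "A' = A - B"
  define l' where "l' x = (if C x then Some e else l x)" for x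
  note SA = regular_barrierD(1)[OF bar] and dis = regular_barrierD(2)[OF bar]
    and lab = regular_barrierD(3)[OF bar] and out = regular_barrierD(4)[OF bar]
    and mid = regular_barrierD(5)[OF bar]
  have teB: "t e \<notin> B" and teA: "t e \<in> A" using SB teS SA by auto
  have e1: "t1 e = t e" "h1 e = h e" "e \<in> E1" using teB e_in by (auto simp: t1_def h1_def E1_def)
  have base: "h e \<in> A \<or> l (h e) = Some e" using out[OF e1(3)] e1 teA by auto
  have base': "\<sigma> (h e) \<notin> A" using base dis lab by blast
  have lCs: "C (\<sigma> x) \<longleftrightarrow> C x" for x
    using lab[of x] lab[of "\<sigma> x"] unfolding C_def mate_in_B mate_mate by blast
  have lC: "x \<notin> A' \<and> \<sigma> x \<notin> A'" if "C x" for x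
    using that lab[of x] unfolding C_def A'_def by auto
  have lB: "C x" if "x \<in> B" for x using that by (simp add: C_def)
  \<comment> \<open>Trimmed, any other such arc would enter the mate of the base and label it, but
    this mate is the mate of a vertex of \<open>A\<close> or carries the label
    \<open>e\<close>.\<close>
  have enter: "a = e" if a: "a \<in> E" "t a \<in> A'" "h a \<in> B" for a
  proof (rule ccontr)
    assume "a \<noteq> e"
    with a have *: "a \<in> E1" "t1 a = t a" "h1 a = \<sigma> (h e)" by (auto simp: E1_def t1_def h1_def A'_def)
    then have "l (\<sigma> (h e)) = Some a" using out[OF *(1)] a base' by (auto simp: A'_def)
    with lab[OF this] base \<open>a \<noteq> e\<close> show False by auto
  qed
  \<comment> \<open>When \<open>h a\<close> is outside \<open>B\<close>, the trimmed arc
    \<open>a\<close> starts at the base. If the base is in \<open>A\<close>, then \<open>a\<close>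
    itself labels \<open>h a\<close>; otherwise the label \<open>e\<close> of the base is passed on
    along \<open>a\<close>.\<close>
  have leave: "C (h a)" if a: "a \<in> E" "t a \<in> B" "h a \<notin> A'" "\<sigma> (h a) \<notin> A'" for a
  proof (cases "h a \<in> B")
    case False
    then have *: "a \<in> E1" "h1 a = h a" using a by (auto simp: E1_def h1_def)
    have "a \<noteq> \<rho> e"
      using a(4) e_in teA teB by (auto simp: A'_def)
    then have t1: "t1 a = h e" using a by (simp add: t1_def)
    have n: "h a \<notin> A" "\<sigma> (h a) \<notin> A" using False a by (auto simp: A'_def)
    show ?thesis
    proof (cases "h e \<in> A")
      case True
      with out[OF *(1)] * n t1 a show ?thesis by (auto simp: C_def)
    next
      case f: False
      with base have "l (h e) = Some e" by simp
      with mid[OF *(1)] * t1 n f base' have "l (h a) = Some e" by auto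
      then show ?thesis by (simp add: C_def)
    qed
  qed (simp add: lB)
  have "S \<subseteq> A'" "\<forall>x\<in>A'. \<sigma> x \<notin> A'"
    using SA SB dis by (auto simp: A'_def)
  moreover have "x \<notin> A' \<and> \<sigma> x \<notin> A' \<and> l' (\<sigma> x) = Some b \<and> b \<in> E \<and> t b \<in> A' \<and> l' (h b) = Some b"
    if b: "l' x = Some b" for x b
  proof (cases "C x")
    case True
    then have "b = e" using b by (simp add: l'_def)
    with True lC[OF True] e_in teA teB show ?thesis by (auto simp: l'_def lCs lB A'_def)
  next
    case False
    then have lx: "l x = Some b" using b by (simp add: l'_def)
    have b': "b \<noteq> e" "t b \<notin> B" using False lx by (auto simp: C_def)
    note L = lab[OF lx]
    have tb: "t b \<in> A'" "b \<in> E" using L b' by (auto simp: t1_def A'_def E1_def)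
    with enter b' have hb: "h b \<notin> B" by blast
    then have "l (h b) = Some b" using L by (simp add: h1_def)
    with hb b' have "l' (h b) = Some b" by (auto simp: l'_def C_def)
    moreover have "l' (\<sigma> x) = Some b" using L False by (simp add: l'_def lCs)
    ultimately show ?thesis using L tb by (simp add: A'_def)
  qed
  moreover have "h a \<in> A' \<or> l' (h a) = Some a" if a: "a \<in> E" "t a \<in> A'" for a
  proof (cases "h a \<in> B")
    case True
    with enter a have "a = e" by blast
    then show ?thesis by (simp add: l'_def lB)
  next
    case False
    then have *: "a \<in> E1" "t1 a = t a" "h1 a = h a" "a \<noteq> e" "t a \<notin> B"
      using a by (auto simp: E1_def t1_def h1_def A'_def)
    with out[OF *(1)] a False show ?thesis by (auto simp: A'_def l'_def C_def)
  qed
  moreover have "l' (t a) = l' (h a)"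
    if a: "a \<in> E" "t a \<notin> A'" "\<sigma> (t a) \<notin> A'" "h a \<notin> A'" "\<sigma> (h a) \<notin> A'" for a
  proof -
    consider "t a \<in> B" | "h a \<in> B" | "t a \<notin> B" "h a \<notin> B" by blast
    then show ?thesis
    proof cases
      case 1
      with leave a lB show ?thesis by (simp add: l'_def)
    next
      case 2
      \<comment> \<open>Reflection turns an arc entering \<open>B\<close> into one leaving
        it.\<close>
      then have "C (\<sigma> (t a))" using leave[of "\<rho> a"] a by simp
      with 2 lB show ?thesis by (simp add: l'_def lCs)
    next
      case 3
      then have *: "a \<in> E1" "t1 a = t a" "h1 a = h a"
        using a by (auto simp: E1_def t1_def h1_def)
      with mid[OF *(1)] a 3 have "l (t a) = l (h a)" by (auto simp: A'_def)
      with 3 have "C (t a) = C (h a)" by (simp add: C_def)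
      with \<open>l (t a) = l (h a)\<close> show ?thesis by (simp add: l'_def)
    qed
  qed
  ultimately have "regular_barrier E t h \<sigma> S A' l'"
    unfolding regular_barrier_def by simp
  then show ?thesis by blast
qed

end

text \<open>Induction on the number of arcs. An arc \<open>e\<close> leaving \<open>S\<close> is
  deleted with its mate and its head becomes a source. A barrier of the smaller instance still
  works. A regular walk can be completed to one for \<open>S\<close> unless it runs from the head of
  \<open>e\<close> to the mate of that head; then it forms a blossom, which is trimmed if it misses
  \<open>S\<close>.\<close>

theorem regular_reachability:
  assumes "skew_digraph E t h \<sigma> \<rho>" "\<forall>x\<in>S. \<sigma> x \<notin> S"
  shows "regular_connected E t h \<sigma> \<rho> S \<or> (\<exists>A l. regular_barrier E t h \<sigma> S A l)"
  using assms
proof (induction "card E" arbitrary: E t h S rule: less_induct)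
  case less
  interpret skew_digraph E t h \<sigma> \<rho> by (rule less.prems)
  show ?case
  proof (cases "\<exists>e\<in>E. t e \<in> S \<and> h e \<notin> S")
    case False
    then have "regular_barrier E t h \<sigma> S S (\<lambda>_. None)"
      using less.prems(2) by (simp add: regular_barrier_def)
    then show ?thesis by blast
  next
    case True
    then obtain e where e: "e \<in> E" "t e \<in> S" "h e \<notin> S" by blast
    let ?E = "E - {e, \<rho> e}" and ?S = "insert (h e) S"
    show ?thesis
    proof (cases "\<sigma> (h e) \<in> S")
      case True
      have "walk E t h (t e) [e] (\<sigma> (\<sigma> (h e)))" "regular \<rho> [e]"
        using e arc_mate_neq by (auto simp: regular_def)
      with e True show ?thesis unfolding regular_connected_def by blast
    next
      case he: False
      have sk: "skew_digraph ?E t h \<sigma> \<rho>"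
      proof
        fix a assume a: "a \<in> ?E"
        then show "\<rho> a \<in> ?E" using e by (metis Diff_iff arc_mate_in arc_mate_mate insert_iff singletonD)
      qed (use finite_arcs arc_mate_neq tail_not_fixed in auto)
      have "card ?E < card E"
        using e finite_arcs by (intro psubset_card_mono) auto
      moreover have "\<forall>x\<in>?S. \<sigma> x \<notin> ?S"
        using less.prems(2) he e head_not_fixed by (metis insert_iff mate_mate)
      ultimately consider "regular_connected ?E t h \<sigma> \<rho> ?S"
        | A l where "regular_barrier ?E t h \<sigma> ?S A l"
        using less.hyps[OF _ sk] by blast
      then show ?thesis
      proof cases
        case 2
        \<comment> \<open>Both ends of \<open>e\<close> lie in \<open>A\<close> and the ends of
          \<open>\<rho> e\<close> are mates of vertices of \<open>A\<close>, so restoring these two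
          arcs violates no condition.\<close>
        note D = regular_barrierD[OF 2]
        have inA: "h e \<in> A" "t e \<in> A" and notA: "\<sigma> (h e) \<notin> A"
          using D(1) D(2)[of "h e"] e by auto
        have split: "a \<in> ?E \<or> a = e \<or> a = \<rho> e" if "a \<in> E" for a using that by blast
        have "h a \<in> A \<or> l (h a) = Some a" if "a \<in> E" "t a \<in> A" for a
          using split[OF that(1)] D(4)[of a] that(2) inA notA e by (elim disjE) simp_all
        moreover have "l (t a) = l (h a)"
          if "a \<in> E" "t a \<notin> A" "\<sigma> (t a) \<notin> A" "h a \<notin> A" "\<sigma> (h a) \<notin> A" for a
          using split[OF that(1)] D(5)[of a] that(2-) inA e by (elim disjE) simp_all
        ultimately have "regular_barrier E t h \<sigma> S A l"
          using D(1-3) unfolding regular_barrier_def by simp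
        then show ?thesis by blast
      next
        case 1
        then obtain x y p where xy: "x \<in> ?S" "y \<in> ?S" and w: "walk ?E t h x p (\<sigma> y)"
          and reg: "regular \<rho> p" unfolding regular_connected_def by blast
        have wE: "walk E t h x p (\<sigma> y)" using walk_mono[OF w] walk_subset[OF w] by blast
        have pE: "set p \<subseteq> ?E" using walk_subset[OF w] .
        \<comment> \<open>A walk to the mate of \<open>h e\<close> is completed by
          \<open>\<rho> e\<close>, which ends at the mate of the source \<open>t e\<close>.\<close>
        have close: "regular_connected E t h \<sigma> \<rho> S"
          if "x' \<in> S" "walk E t h x' q (\<sigma> (h e))" "regular \<rho> q" "set q \<subseteq> ?E" for x' q
        proof -
          have "walk E t h x' (q @ [\<rho> e]) (\<sigma> (t e))"
            using that e by (auto simp: walk_append)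
          moreover have mates: "\<rho> a \<noteq> \<rho> e" if "a \<in> set q" for a
            using that \<open>set q \<subseteq> ?E\<close> e arc_mate_mate by (metis DiffE insertCI subsetD)
          moreover have "regular \<rho> (q @ [\<rho> e])"
            using that e arc_mate_neq[of e] mates by (auto simp: regular_def)
          ultimately show ?thesis using that e unfolding regular_connected_def by blast
        qed
        have close': "regular_connected E t h \<sigma> \<rho> S"
          if "y' \<in> S" "walk E t h (h e) q (\<sigma> y')" "regular \<rho> q" "set q \<subseteq> ?E" for y' q
        proof (rule close[OF that(1), of "rev (map \<rho> q)"])
          show "walk E t h y' (rev (map \<rho> q)) (\<sigma> (h e))" using walk_mate[OF that(2)] by simp
          show "regular \<rho> (rev (map \<rho> q))" using that by (intro regular_mate) auto
          show "set (rev (map \<rho> q)) \<subseteq> ?E" using that(4) skew_digraph.arc_mate_in[OF sk] by auto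
        qed
        consider "x \<in> S" "y \<in> S" | "x \<in> S" "y = h e" | "x = h e" "y \<in> S" | "x = h e" "y = h e"
          using xy by blast
        then show ?thesis
        proof cases
          case 1
          with wE reg show ?thesis unfolding regular_connected_def by blast
        next
          case 2
          with close wE reg pE show ?thesis by blast
        next
          case 3
          with close' wE reg pE show ?thesis by blast
        next
          case 4
          interpret blossom E t h \<sigma> \<rho> e p
            using e(1) w reg 4 skew_digraph_axioms
            by (simp add: blossom_def blossom_axioms_def)
          show ?thesis
          proof (cases "S \<inter> B = {}")
            case True
            have "regular_connected E1 t1 h1 \<sigma> \<rho> S \<or> (\<exists>A l. regular_barrier E1 t1 h1 \<sigma> S A l)"
              using less.hyps[OF card_E1 trimmed_skew less.prems(2)] .
            then show ?thesis
              using regular_connected_untrim regular_barrier_untrim True e by blast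
          next
            case False
            \<comment> \<open>If \<open>z\<close> is on \<open>p\<close>, the final segment from
              \<open>z\<close> is completed by \<open>close\<close>; if its mate is on
              \<open>p\<close>, the initial segment up to that mate is completed by
              \<open>close'\<close>.\<close>
            then obtain z where z: "z \<in> S" "z \<in> B" by blast
            from z(2) show ?thesis
            proof (cases rule: B_cases)
              case 1
              obtain q r where "p = q @ r" "walk E t h z r (\<sigma> y)"
                using walk_split[OF wE 1] by metis
              then show ?thesis using close[of z r] z 4 reg pE by (auto simp: regular_def)
            next
              case 2
              obtain q r where "p = q @ r" "walk E t h x q (\<sigma> z)"
                using walk_split[OF wE 2] by metis
              then show ?thesis using close'[of z q] z 4 reg pE by (auto simp: regular_def)
            qed
          qed
        qed
      qed
    qed
  qed
qed

section \<open>Symmetric flows with unit capacities\<close>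

lemma even_sum_involution:
  fixes g :: "'a \<Rightarrow> nat"
  assumes "finite X" "\<And>x. x \<in> X \<Longrightarrow> \<tau> x \<in> X \<and> \<tau> x \<noteq> x \<and> \<tau> (\<tau> x) = x \<and> g (\<tau> x) = g x"
  shows "even (\<Sum>x\<in>X. g x)"
  using assms
proof (induction "card X" arbitrary: X rule: less_induct)
  case less
  show ?case
  proof (cases "X = {}")
    case False
    then obtain x where x: "x \<in> X" by blast
    let ?Y = "X - {x, \<tau> x}"
    note L = less.prems(2)
    have "even (\<Sum>x\<in>?Y. g x)"
    proof (rule less.hyps)
      show "card ?Y < card X" using x less.prems(1) by (intro psubset_card_mono) auto
      show "finite ?Y" using less.prems(1) by simp
      show "\<tau> y \<in> ?Y \<and> \<tau> y \<noteq> y \<and> \<tau> (\<tau> y) = y \<and> g (\<tau> y) = g y" if "y \<in> ?Y" for y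
        using that L[of y] L[OF x] by (metis Diff_iff insert_iff singletonD)
    qed
    moreover have "(\<Sum>x\<in>X. g x) = (\<Sum>x\<in>?Y. g x) + (\<Sum>x\<in>{x, \<tau> x}. g x)"
      using x L[OF x] less.prems(1) by (intro sum.subset_diff) auto
    moreover have "(\<Sum>x\<in>{x, \<tau> x}. g x) = 2 * g x"
      using L[OF x] by auto
    ultimately show ?thesis by simp
  qed simp
qed

section \<open>Net outflow and the residual graph\<close>

definition net_outflow :: "('e \<Rightarrow> 'v) \<Rightarrow> ('e \<Rightarrow> 'v) \<Rightarrow> 'e set \<Rightarrow> 'v \<Rightarrow> int" where
  "net_outflow t h F x = (\<Sum>r\<in>F. of_bool (t r = x) - of_bool (h r = x))"

definition residual_tail :: "('e \<Rightarrow> 'v) \<Rightarrow> ('e \<Rightarrow> 'v) \<Rightarrow> 'e set \<Rightarrow> 'e \<Rightarrow> 'v" where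
  "residual_tail t h F r = (if r \<in> F then h r else t r)"

definition residual_head :: "('e \<Rightarrow> 'v) \<Rightarrow> ('e \<Rightarrow> 'v) \<Rightarrow> 'e set \<Rightarrow> 'e \<Rightarrow> 'v" where
  "residual_head t h F r = (if r \<in> F then t r else h r)"

lemma net_outflow_eq_card:
  assumes "finite F"
  shows "net_outflow t h F x = int (card {r \<in> F. t r = x}) - int (card {r \<in> F. h r = x})"
  using assms by (simp add: net_outflow_def sum_subtractf Int_def)

lemma net_outflow_walk:
  assumes "walk E t h x p y" "distinct p"
  shows "net_outflow t h (set p) z = of_bool (x = z) - of_bool (y = z)"
  using assms
  by (induction p arbitrary: x) (auto simp: net_outflow_def)

lemma sum_net_outflow:
  assumes "finite A" "finite F"
  shows "(\<Sum>x\<in>A. net_outflow t h F x) =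
    int (card {r \<in> F. t r \<in> A \<and> h r \<notin> A}) - int (card {r \<in> F. t r \<notin> A \<and> h r \<in> A})"
proof -
  have "(\<Sum>x\<in>A. net_outflow t h F x) = (\<Sum>r\<in>F. \<Sum>x\<in>A. of_bool (t r = x) - of_bool (h r = x))"
    unfolding net_outflow_def by (rule sum.swap)
  also have "\<dots> = (\<Sum>r\<in>F. of_bool (t r \<in> A) - of_bool (h r \<in> A))"
    using assms(1) by (intro sum.cong refl) (simp add: sum_subtractf of_bool_def)
  also have "\<dots> = (\<Sum>r\<in>F. of_bool (t r \<in> A \<and> h r \<notin> A) - of_bool (t r \<notin> A \<and> h r \<in> A))"
    by (intro sum.cong refl) auto
  also have "\<dots> = int (card {r \<in> F. t r \<in> A \<and> h r \<notin> A}) - int (card {r \<in> F. t r \<notin> A \<and> h r \<in> A})"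
    using assms(2) by (simp add: sum_subtractf Int_def)
  finally show ?thesis .
qed

context skew_digraph
begin

text \<open>A symmetric flow with unit capacities, given by the set of arcs that it uses.\<close>

definition unit_flow :: "'v \<Rightarrow> 'e set \<Rightarrow> bool" where
  "unit_flow s F \<longleftrightarrow> F \<subseteq> E \<and> (\<forall>r\<in>F. \<rho> r \<in> F) \<and>
     (\<forall>x. x \<noteq> s \<longrightarrow> x \<noteq> \<sigma> s \<longrightarrow> net_outflow t h F x = 0)"

lemma unit_flow_subset: "unit_flow s F \<Longrightarrow> F \<subseteq> E"
  by (simp add: unit_flow_def)

lemma unit_flow_finite: "unit_flow s F \<Longrightarrow> finite F"
  using finite_arcs finite_subset unit_flow_subset by blast

lemma unit_flow_mate_iff: "unit_flow s F \<Longrightarrow> r \<in> E \<Longrightarrow> \<rho> r \<in> F \<longleftrightarrow> r \<in> F"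
  unfolding unit_flow_def by (metis arc_mate_mate)

lemma residual_skew:
  assumes "unit_flow s F"
  shows "skew_digraph E (residual_tail t h F) (residual_head t h F) \<sigma> \<rho>"
proof
  fix a assume a: "a \<in> E"
  show "\<rho> a \<in> E" "\<rho> a \<noteq> a" "\<rho> (\<rho> a) = a" using a arc_mate_neq by auto
  show "residual_tail t h F (\<rho> a) = \<sigma> (residual_head t h F a)"
    "residual_head t h F (\<rho> a) = \<sigma> (residual_tail t h F a)"
    using a unit_flow_mate_iff[OF assms a] by (simp_all add: residual_tail_def residual_head_def)
  show "\<sigma> (residual_tail t h F a) \<noteq> residual_tail t h F a"
    using a tail_not_fixed head_not_fixed by (simp add: residual_tail_def)
qed (use finite_arcs in simp_all)

lemma net_outflow_mate:
  assumes "D \<subseteq> E"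
  shows "net_outflow t h (\<rho> ` D) x = - net_outflow t h D (\<sigma> x)"
proof -
  have inj: "inj_on \<rho> D"
    using assms by (intro inj_on_inverseI[of _ \<rho>]) auto
  have "net_outflow t h (\<rho> ` D) x = (\<Sum>r\<in>D. of_bool (t (\<rho> r) = x) - of_bool (h (\<rho> r) = x))"
    unfolding net_outflow_def using inj by (simp add: sum.reindex)
  also have "\<dots> = (\<Sum>r\<in>D. - (of_bool (t r = \<sigma> x) - of_bool (h r = \<sigma> x)))"
  proof (intro sum.cong refl)
    fix r assume "r \<in> D"
    then have "r \<in> E" using assms by blast
    moreover have "\<sigma> y = x \<longleftrightarrow> y = \<sigma> x" for y by (metis mate_mate)
    ultimately show "of_bool (t (\<rho> r) = x) - of_bool (h (\<rho> r) = x)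
      = - (of_bool (t r = \<sigma> x) - of_bool (h r = \<sigma> x) :: int)" by simp
  qed
  finally show ?thesis by (simp only: net_outflow_def sum_negf)
qed

lemma net_outflow_augment:
  assumes "F \<subseteq> E" "D \<subseteq> E"
  shows "net_outflow t h ((F - D) \<union> (D - F)) x =
    net_outflow t h F x + net_outflow (residual_tail t h F) (residual_head t h F) D x"
proof -
  let ?d = "\<lambda>r. of_bool (t r = x) - of_bool (h r = x) :: int"
  let ?d' = "\<lambda>r. of_bool (residual_tail t h F r = x) - of_bool (residual_head t h F r = x) :: int"
  have restrict: "sum g G = (\<Sum>r\<in>E. if r \<in> G then g r else 0)" if "G \<subseteq> E" for g :: "'e \<Rightarrow> int" and G
    using that finite_arcs by (simp add: sum.If_cases Int_absorb1 flip: sum.inter_restrict)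
  have "(F - D) \<union> (D - F) \<subseteq> E" using assms by blast
  then have "net_outflow t h ((F - D) \<union> (D - F)) x
      = (\<Sum>r\<in>E. if r \<in> (F - D) \<union> (D - F) then ?d r else 0)"
    unfolding net_outflow_def by (rule restrict)
  also have "\<dots> = (\<Sum>r\<in>E. (if r \<in> F then ?d r else 0) + (if r \<in> D then ?d' r else 0))"
    by (intro sum.cong refl) (auto simp: residual_tail_def residual_head_def)
  also have "\<dots> = net_outflow t h F x + net_outflow (residual_tail t h F) (residual_head t h F) D x"
    unfolding net_outflow_def restrict[OF assms(1)] restrict[OF assms(2)] by (rule sum.distrib)
  finally show ?thesis .
qed

text \<open>The walk and its mirror image both lead from \<open>s\<close> to its mate, and
  regularity makes them arc-disjoint, so augmenting along both keeps the flow symmetric.\<close>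

lemma unit_flow_augment:
  assumes F: "unit_flow s F" and s: "\<sigma> s \<noteq> s"
    and p: "walk E (residual_tail t h F) (residual_head t h F) s p (\<sigma> s)" "regular \<rho> p"
  shows "\<exists>F'. unit_flow s F' \<and> net_outflow t h F s < net_outflow t h F' s"
proof -
  let ?t = "residual_tail t h F" and ?h = "residual_head t h F"
  interpret res: skew_digraph E ?t ?h \<sigma> \<rho> by (rule residual_skew[OF F])
  define D where "D = set p \<union> \<rho> ` set p"
  define F' where "F' = (F - D) \<union> (D - F)"
  have pE: "set p \<subseteq> E" using walk_subset[OF p(1)] .
  have DE: "D \<subseteq> E" using pE by (auto simp: D_def)
  have FE: "F \<subseteq> E" using F by (simp add: unit_flow_def)
  have "set p \<inter> \<rho> ` set p = {}"
    using p(2) pE by (auto simp: regular_def)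
  then have "net_outflow ?t ?h D x = net_outflow ?t ?h (set p) x + net_outflow ?t ?h (\<rho> ` set p) x" for x
    unfolding D_def net_outflow_def by (intro sum.union_disjoint) auto
  moreover have "net_outflow ?t ?h (set p) x = of_bool (s = x) - of_bool (\<sigma> s = x)" for x
    using net_outflow_walk[OF p(1)] p(2) by (auto simp: regular_def)
  moreover have "\<sigma> s = \<sigma> x \<longleftrightarrow> s = x" "s = \<sigma> x \<longleftrightarrow> \<sigma> s = x" for x by (metis mate_mate)+
  ultimately have netD: "net_outflow ?t ?h D x = 2 * (of_bool (s = x) - of_bool (\<sigma> s = x))" for x
    using res.net_outflow_mate[OF pE] by simp
  have net: "net_outflow t h F' x = net_outflow t h F x + 2 * (of_bool (s = x) - of_bool (\<sigma> s = x))" for x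
    unfolding F'_def net_outflow_augment[OF FE DE] netD ..
  have "\<rho> r \<in> D" if "r \<in> D" for r
    using that pE by (auto simp: D_def)
  then have "\<rho> r \<in> D \<longleftrightarrow> r \<in> D" if "r \<in> E" for r
    using that arc_mate_mate by metis
  then have "\<forall>r\<in>F'. \<rho> r \<in> F'"
    using unit_flow_mate_iff[OF F] FE DE unfolding F'_def by blast
  moreover have "F' \<subseteq> E" using FE DE by (auto simp: F'_def)
  ultimately have "unit_flow s F'"
    using F net unfolding unit_flow_def by simp
  moreover have "net_outflow t h F s < net_outflow t h F' s" using net s by simp
  ultimately show ?thesis by blast
qed

text \<open>Among the finitely many unit flows take one of maximal value. It admits no regular
  augmenting walk, so regular reachability supplies the barrier.\<close>

lemma unit_flow_residual_barrier:
  assumes s: "\<sigma> s \<noteq> s"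
  shows "\<exists>F A l. unit_flow s F \<and>
    regular_barrier E (residual_tail t h F) (residual_head t h F) \<sigma> {s} A l"
proof -
  have "finite {F. unit_flow s F}"
    using finite_arcs by - (rule finite_subset[of _ "Pow E"], auto dest: unit_flow_subset)
  moreover have "unit_flow s {}" by (simp add: unit_flow_def net_outflow_def)
  ultimately obtain F where F: "unit_flow s F"
    and max: "\<And>F'. unit_flow s F' \<Longrightarrow> net_outflow t h F' s \<le> net_outflow t h F s"
    using ex_is_arg_min_if_finite[of "{F. unit_flow s F}" "\<lambda>F. - net_outflow t h F s"]
    by (auto simp: is_arg_min_linorder)
  have "\<not> regular_connected E (residual_tail t h F) (residual_head t h F) \<sigma> \<rho> {s}"
    using unit_flow_augment[OF F s] max unfolding regular_connected_def by fastforce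
  with regular_reachability[OF residual_skew[OF F], of "{s}"] s F show ?thesis by auto
qed

section \<open>Parity of flows across self-symmetric sets, and cuts\<close>

lemma card_mate:
  assumes "F \<subseteq> E" "\<forall>r\<in>F. \<rho> r \<in> F" "\<And>r. r \<in> F \<Longrightarrow> P (\<rho> r) \<longleftrightarrow> Q r"
  shows "card {r \<in> F. P r} = card {r \<in> F. Q r}"
proof (rule bij_betw_same_card[of \<rho>])
  have "\<rho> r \<in> F" "\<rho> (\<rho> r) = r" if "r \<in> F" for r using assms that by auto
  then show "bij_betw \<rho> {r \<in> F. P r} {r \<in> F. Q r}"
    using assms(3) by (intro bij_betw_byWitness[where f' = \<rho>]) (auto, metis)
qed

text \<open>By conservation and symmetry the out-degrees at \<open>x\<close> and its mate agree, so
  the total out-degree over \<open>X\<close> is even. Arcs with both ends in \<open>X\<close> come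
  in mate pairs; removing them preserves parity.\<close>

lemma unit_flow_leaving_even:
  assumes F: "unit_flow s F" and X: "finite X" "\<And>x. x \<in> X \<Longrightarrow> \<sigma> x \<in> X \<and> \<sigma> x \<noteq> x" and s: "s \<notin> X"
  shows "even (card {r \<in> F. t r \<in> X \<and> h r \<notin> X})"
proof -
  have fin: "finite F" using unit_flow_finite[OF F] .
  have FE: "F \<subseteq> E" and cl: "\<forall>r\<in>F. \<rho> r \<in> F" using F by (auto simp: unit_flow_def)
  have s': "\<sigma> s \<notin> X" using X(2)[of "\<sigma> s"] s by auto
  let ?out = "\<lambda>x. card {r \<in> F. t r = x}"
  have "?out (\<sigma> x) = ?out x" if "x \<in> X" for x
  proof -
    have "net_outflow t h F x = 0"
      using that s s' F unfolding unit_flow_def by metis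
    then have "?out x = card {r \<in> F. h r = x}"
      using net_outflow_eq_card[OF fin, of t h x] by simp
    also have "\<dots> = ?out (\<sigma> x)"
    proof (rule card_mate[OF FE cl])
      fix r assume "r \<in> F"
      then have "r \<in> E" using FE by blast
      then show "h (\<rho> r) = x \<longleftrightarrow> t r = \<sigma> x" by (metis head_mate mate_mate)
    qed
    finally show ?thesis ..
  qed
  with X have "even (\<Sum>x\<in>X. ?out x)"
    by (intro even_sum_involution[where \<tau> = \<sigma>]) auto
  also have "(\<Sum>x\<in>X. ?out x) = card (\<Union>x\<in>X. {r \<in> F. t r = x})"
    using X(1) fin by (intro card_UN_disjoint[symmetric]) auto
  also have "(\<Union>x\<in>X. {r \<in> F. t r = x}) = {r \<in> F. t r \<in> X \<and> h r \<notin> X} \<union> {r \<in> F. t r \<in> X \<and> h r \<in> X}"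
    by auto
  also have "card \<dots> = card {r \<in> F. t r \<in> X \<and> h r \<notin> X} + card {r \<in> F. t r \<in> X \<and> h r \<in> X}"
    using fin by (intro card_Un_disjoint) auto
  finally have sum: "even (card {r \<in> F. t r \<in> X \<and> h r \<notin> X} + card {r \<in> F. t r \<in> X \<and> h r \<in> X})" .
  have "even (\<Sum>r\<in>{r \<in> F. t r \<in> X \<and> h r \<in> X}. 1 :: nat)"
  proof (rule even_sum_involution[where \<tau> = \<rho>])
    fix r assume r: "r \<in> {r \<in> F. t r \<in> X \<and> h r \<in> X}"
    then have "r \<in> E" "\<rho> r \<in> F" "r \<in> F" using FE cl by auto
    with r X(2) arc_mate_neq show "\<rho> r \<in> {r \<in> F. t r \<in> X \<and> h r \<in> X} \<and> \<rho> r \<noteq> r \<and> \<rho> (\<rho> r) = r \<and> (1::nat) = 1"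
      by auto
  qed (use fin in simp)
  with sum show ?thesis by simp
qed

text \<open>Flow arcs leaving \<open>X\<close> go to \<open>A\<close> or to mates of
  \<open>A\<close>, and the latter mirror those from \<open>A\<close> to \<open>X\<close>. Thus the
  flow from \<open>A\<close> to \<open>X\<close> plus the flow back is even, while the residual
  count is the capacity minus the first plus the second.\<close>

lemma residual_entering_parity:
  assumes F: "unit_flow s F" and X: "finite X" "\<And>x. x \<in> X \<Longrightarrow> \<sigma> x \<in> X \<and> \<sigma> x \<noteq> x" and s: "s \<notin> X"
    and A: "\<And>x. x \<in> A \<Longrightarrow> \<sigma> x \<notin> A" "A \<inter> X = {}"
    and sep: "\<And>r. r \<in> E \<Longrightarrow> t r \<in> X \<Longrightarrow> h r \<in> X \<or> h r \<in> A \<or> \<sigma> (h r) \<in> A"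
  shows "even (card {r \<in> E. residual_tail t h F r \<in> A \<and> residual_head t h F r \<in> X}) \<longleftrightarrow>
    even (card {r \<in> E. t r \<in> A \<and> h r \<in> X})"
proof -
  have fin: "finite F" using unit_flow_finite[OF F] .
  have FE: "F \<subseteq> E" and cl: "\<forall>r\<in>F. \<rho> r \<in> F" using F by (auto simp: unit_flow_def)
  have XA: "x \<notin> A" "\<sigma> x \<notin> A" if "x \<in> X" for x using that A(2) X(2) by blast+
  have "{r \<in> F. t r \<in> X \<and> h r \<notin> X} = {r \<in> F. t r \<in> X \<and> h r \<in> A} \<union> {r \<in> F. t r \<in> X \<and> \<sigma> (h r) \<in> A}"
    using sep FE XA by blast
  also have "card \<dots> = card {r \<in> F. t r \<in> X \<and> h r \<in> A} + card {r \<in> F. t r \<in> X \<and> \<sigma> (h r) \<in> A}"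
    using fin A(1) by (intro card_Un_disjoint) auto
  also have "card {r \<in> F. t r \<in> X \<and> \<sigma> (h r) \<in> A} = card {r \<in> F. t r \<in> A \<and> h r \<in> X}"
  proof (rule card_mate[OF FE cl])
    fix r assume "r \<in> F"
    then have "r \<in> E" using FE by blast
    moreover have "\<sigma> x \<in> X \<longleftrightarrow> x \<in> X" for x using X(2) mate_mate by metis
    ultimately show "t (\<rho> r) \<in> X \<and> \<sigma> (h (\<rho> r)) \<in> A \<longleftrightarrow> t r \<in> A \<and> h r \<in> X" by auto
  qed
  finally have ev: "even (card {r \<in> F. t r \<in> X \<and> h r \<in> A} + card {r \<in> F. t r \<in> A \<and> h r \<in> X})"
    using unit_flow_leaving_even[OF F X s] by simp
  have "{r \<in> E. residual_tail t h F r \<in> A \<and> residual_head t h F r \<in> X}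
      = {r \<in> E - F. t r \<in> A \<and> h r \<in> X} \<union> {r \<in> F. t r \<in> X \<and> h r \<in> A}"
    using FE by (auto simp: residual_tail_def residual_head_def)
  also have "card \<dots> = card {r \<in> E - F. t r \<in> A \<and> h r \<in> X} + card {r \<in> F. t r \<in> X \<and> h r \<in> A}"
    using fin finite_arcs by (intro card_Un_disjoint) auto
  finally have res: "card {r \<in> E. residual_tail t h F r \<in> A \<and> residual_head t h F r \<in> X} = \<dots>" .
  have "{r \<in> E. t r \<in> A \<and> h r \<in> X} = {r \<in> E - F. t r \<in> A \<and> h r \<in> X} \<union> {r \<in> F. t r \<in> A \<and> h r \<in> X}"
    using FE by auto
  also have "card \<dots> = card {r \<in> E - F. t r \<in> A \<and> h r \<in> X} + card {r \<in> F. t r \<in> A \<and> h r \<in> X}"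
    using fin finite_arcs by (intro card_Un_disjoint) auto
  finally show ?thesis using ev res by presburger
qed

text \<open>Each flow arc out of \<open>A\<close> removes a residual arc from the cut and each flow
  arc into \<open>A\<close> adds one; the difference of the two numbers is the flow value.\<close>

lemma unit_flow_cut:
  assumes F: "unit_flow s F" and A: "finite A" "s \<in> A" "\<sigma> s \<notin> A"
  shows "net_outflow t h F s = int (card {r \<in> E. t r \<in> A \<and> h r \<notin> A}) -
    int (card {r \<in> E. residual_tail t h F r \<in> A \<and> residual_head t h F r \<notin> A})"
proof -
  have fin: "finite F" using unit_flow_finite[OF F] .
  have FE: "F \<subseteq> E" using F by (auto simp: unit_flow_def)
  have "net_outflow t h F x = 0" if "x \<in> A - {s}" for x
    using that A F unfolding unit_flow_def by blast
  then have "net_outflow t h F s = (\<Sum>x\<in>A. net_outflow t h F x)"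
    using A by (simp add: sum.remove[of A s])
  also have "\<dots> = int (card {r \<in> F. t r \<in> A \<and> h r \<notin> A}) - int (card {r \<in> F. t r \<notin> A \<and> h r \<in> A})"
    by (rule sum_net_outflow[OF A(1) fin])
  finally have 1: "net_outflow t h F s = \<dots>" .
  have "{r \<in> E. residual_tail t h F r \<in> A \<and> residual_head t h F r \<notin> A}
      = {r \<in> E - F. t r \<in> A \<and> h r \<notin> A} \<union> {r \<in> F. t r \<notin> A \<and> h r \<in> A}"
    using FE by (auto simp: residual_tail_def residual_head_def)
  also have "card \<dots> = card {r \<in> E - F. t r \<in> A \<and> h r \<notin> A} + card {r \<in> F. t r \<notin> A \<and> h r \<in> A}"
    using fin finite_arcs by (intro card_Un_disjoint) auto
  finally have 2: "card {r \<in> E. residual_tail t h F r \<in> A \<and> residual_head t h F r \<notin> A} = \<dots>" .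
  have "{r \<in> E. t r \<in> A \<and> h r \<notin> A} = {r \<in> E - F. t r \<in> A \<and> h r \<notin> A} \<union> {r \<in> F. t r \<in> A \<and> h r \<notin> A}"
    using FE by auto
  also have "card \<dots> = card {r \<in> E - F. t r \<in> A \<and> h r \<notin> A} + card {r \<in> F. t r \<in> A \<and> h r \<notin> A}"
    using fin finite_arcs by (intro card_Un_disjoint) auto
  finally show ?thesis using 1 2 by simp
qed

end

section \<open>Reduction to unit capacities\<close>

locale skew_network =
  fixes V :: "'v set" and E :: "'e set" and tail head :: "'e \<Rightarrow> 'v"
    and sv :: "'v \<Rightarrow> 'v" and se :: "'e \<Rightarrow> 'e" and u :: "'e \<Rightarrow> nat" and s :: 'v
  assumes network: "skew_symmetric_network V E tail head sv se u s"
begin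

text \<open>Each arc \<open>a\<close> is split into the unit arcs \<open>(a, i)\<close> with \<open>i < u a\<close>; the vertex involution is
extended to be the identity outside \<open>V\<close>, where \<open>sv\<close> is unspecified.\<close>

definition unit_arcs :: "('e \<times> nat) set" where "unit_arcs = (SIGMA a:E. {..<u a})"
definition unit_tail :: "'e \<times> nat \<Rightarrow> 'v" where "unit_tail r = tail (fst r)"
definition unit_head :: "'e \<times> nat \<Rightarrow> 'v" where "unit_head r = head (fst r)"
definition mate :: "'v \<Rightarrow> 'v" where "mate x = (if x \<in> V then sv x else x)"
definition unit_mate :: "'e \<times> nat \<Rightarrow> 'e \<times> nat" where "unit_mate r = (se (fst r), snd r)"

lemma finite_V: "finite V" and finite_E: "finite E"
  and ends_in_V: "a \<in> E \<Longrightarrow> tail a \<in> V" "a \<in> E \<Longrightarrow> head a \<in> V"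
  and sv_V: "x \<in> V \<Longrightarrow> sv x \<in> V" "x \<in> V \<Longrightarrow> sv x \<noteq> x" "x \<in> V \<Longrightarrow> sv (sv x) = x"
  and se_E: "a \<in> E \<Longrightarrow> se a \<in> E" "a \<in> E \<Longrightarrow> se a \<noteq> a" "a \<in> E \<Longrightarrow> se (se a) = a"
  and se_ends: "a \<in> E \<Longrightarrow> tail (se a) = sv (head a)" "a \<in> E \<Longrightarrow> head (se a) = sv (tail a)"
  and u_sym: "a \<in> E \<Longrightarrow> u (se a) = u a" and s_V: "s \<in> V"
  using network unfolding skew_symmetric_network_def skew_symmetric_graph_def by simp_all

lemma unit_ends_in_V: "r \<in> unit_arcs \<Longrightarrow> unit_tail r \<in> V" "r \<in> unit_arcs \<Longrightarrow> unit_head r \<in> V"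
  by (auto simp: unit_arcs_def unit_tail_def unit_head_def ends_in_V)

lemma unit_skew: "skew_digraph unit_arcs unit_tail unit_head mate unit_mate"
proof
  show "finite unit_arcs" using finite_E by (simp add: unit_arcs_def)
  show "mate (mate x) = x" for x by (simp add: mate_def sv_V)
next
  fix r assume r: "r \<in> unit_arcs"
  then have a: "fst r \<in> E" "snd r < u (fst r)" by (auto simp: unit_arcs_def)
  then show "unit_mate r \<in> unit_arcs" by (simp add: unit_arcs_def unit_mate_def se_E u_sym)
  show "unit_mate r \<noteq> r" "unit_mate (unit_mate r) = r"
    using a by (auto simp: unit_mate_def se_E prod_eq_iff)
  show "unit_tail (unit_mate r) = mate (unit_head r)" "unit_head (unit_mate r) = mate (unit_tail r)"
    "mate (unit_tail r) \<noteq> unit_tail r"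
    using a by (simp_all add: unit_tail_def unit_head_def unit_mate_def mate_def se_ends ends_in_V sv_V)
qed

sublocale unit: skew_digraph unit_arcs unit_tail unit_head mate unit_mate
  by (rule unit_skew)

lemma cap_between_eq_card:
  "cap_between E tail head u X Y = card {r \<in> unit_arcs. unit_tail r \<in> X \<and> unit_head r \<in> Y}"
proof -
  have "{r \<in> unit_arcs. unit_tail r \<in> X \<and> unit_head r \<in> Y}
      = (SIGMA a:{a \<in> E. tail a \<in> X \<and> head a \<in> Y}. {..<u a})"
    by (auto simp: unit_arcs_def unit_tail_def unit_head_def)
  then show ?thesis using finite_E by (simp add: cap_between_def)
qed

text \<open>Reduces both halves of the duality to comparing the number of residual arcs leaving
  \<open>A\<close> with the number of components.\<close>

lemma barrier_capacity_eq:
  assumes "unit.unit_flow s F" "A \<subseteq> V" "s \<in> A" "sv s \<notin> A"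
  shows "barrier_capacity V E tail head u A Xs - net_outflow unit_tail unit_head F s =
    int (card {r \<in> unit_arcs. residual_tail unit_tail unit_head F r \<in> A \<and>
      residual_head unit_tail unit_head F r \<notin> A}) - int (length Xs)"
proof -
  have "{r \<in> unit_arcs. unit_tail r \<in> A \<and> unit_head r \<in> V - A}
      = {r \<in> unit_arcs. unit_tail r \<in> A \<and> unit_head r \<notin> A}"
    using unit_ends_in_V by blast
  moreover have "finite A" using assms(2) finite_V finite_subset by blast
  ultimately show ?thesis
    using unit.unit_flow_cut[OF assms(1), of A] assms(3,4) s_V
    by (simp add: barrier_capacity_def cap_between_eq_card mate_def)
qed

section \<open>Translation between integer symmetric flows and unit flows\<close>

lemma net_outflow_unit:
  assumes "F \<subseteq> unit_arcs" "\<And>a. a \<in> E \<Longrightarrow> f a = real (card {i. (a, i) \<in> F})"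
  shows "outflow E tail f x - inflow E head f x = real_of_int (net_outflow unit_tail unit_head F x)"
proof -
  have fin: "finite F" using assms(1) unit.finite_arcs finite_subset by blast
  have sum: "sum f E' = real (card {r \<in> F. fst r \<in> E'})" if "E' \<subseteq> E" for E'
  proof -
    have "{i. (a, i) \<in> F} \<subseteq> snd ` F" for a by force
    then have "\<forall>a\<in>E'. finite {i. (a, i) \<in> F}" using fin finite_subset by blast
    moreover have "finite E'" using that finite_E finite_subset by blast
    moreover have "{r \<in> F. fst r \<in> E'} = (SIGMA a:E'. {i. (a, i) \<in> F})" by auto
    moreover have "sum f E' = (\<Sum>a\<in>E'. real (card {i. (a, i) \<in> F}))"
      using that assms(2) by (intro sum.cong) auto
    ultimately show ?thesis by simp
  qed
  have "{r \<in> F. fst r \<in> {a \<in> E. tail a = x}} = {r \<in> F. unit_tail r = x}"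
    "{r \<in> F. fst r \<in> {a \<in> E. head a = x}} = {r \<in> F. unit_head r = x}"
    using assms(1) by (auto simp: unit_arcs_def unit_tail_def unit_head_def)
  then show ?thesis
    unfolding outflow_def inflow_def net_outflow_eq_card[OF fin] by (subst (1 2) sum) auto
qed

lemma IS_flow_of_unit_flow:
  assumes F: "unit.unit_flow s F"
  defines "f \<equiv> \<lambda>a. real (card {i. (a, i) \<in> F})"
  shows "is_IS_flow V E tail head sv se u s f"
    and "flow_value E tail head s f = real_of_int (net_outflow unit_tail unit_head F s)"
proof -
  note FR = unit.unit_flow_subset[OF F]
  have net: "outflow E tail f x - inflow E head f x = real_of_int (net_outflow unit_tail unit_head F x)" for x
    using net_outflow_unit[OF FR] by (simp add: f_def)
  then show "flow_value E tail head s f = real_of_int (net_outflow unit_tail unit_head F s)"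
    by (simp add: flow_value_def)
  have "f a \<le> real (u a)" for a
  proof -
    have "{i. (a, i) \<in> F} \<subseteq> {..<u a}" using FR by (auto simp: unit_arcs_def)
    then have "card {i. (a, i) \<in> F} \<le> card {..<u a}" by (intro card_mono) auto
    then show ?thesis by (simp add: f_def)
  qed
  moreover have "inflow E head f x = outflow E tail f x" if "x \<in> V - {s, sv s}" for x
    using that net[of x] F s_V by (simp add: unit.unit_flow_def mate_def)
  moreover have "f (se a) = f a" if "a \<in> E" for a
  proof -
    have "(se a, i) \<in> F \<longleftrightarrow> (a, i) \<in> F" for i
    proof (cases "i < u a")
      case True
      with that have "(a, i) \<in> unit_arcs" by (simp add: unit_arcs_def)
      from unit.unit_flow_mate_iff[OF F this] show ?thesis by (simp add: unit_mate_def)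
    next
      case False
      then show ?thesis using FR u_sym[OF that] by (auto simp: unit_arcs_def)
    qed
    then show ?thesis by (simp add: f_def)
  qed
  ultimately show "is_IS_flow V E tail head sv se u s f"
    unfolding is_IS_flow_def is_flow_def by (simp add: f_def)
qed

lemma unit_flow_of_IS_flow:
  assumes f: "is_IS_flow V E tail head sv se u s f"
  obtains F where "unit.unit_flow s F"
    "flow_value E tail head s f = real_of_int (net_outflow unit_tail unit_head F s)"
proof -
  \<comment> \<open>Taking the lowest indices on every arc makes \<open>F\<close> closed under
    \<open>unit_mate\<close>, because \<open>f\<close> agrees on an arc and its mate.\<close>
  define F where "F = (SIGMA a:E. {..<nat \<lfloor>f a\<rfloor>})"
  have fE: "0 \<le> f a" "f a \<le> real (u a)" "f a \<in> \<int>" "f (se a) = f a" if "a \<in> E" for a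
    using f that by (auto simp: is_IS_flow_def is_flow_def)
  have "nat \<lfloor>f a\<rfloor> \<le> u a" if "a \<in> E" for a
    using fE[OF that] by linarith
  then have FR: "F \<subseteq> unit_arcs" by (fastforce simp: F_def unit_arcs_def)
  have "f a = real (card {i. (a, i) \<in> F})" if "a \<in> E" for a
    using fE(1,3)[OF that] that by (auto simp: F_def elim!: Ints_cases)
  note net = net_outflow_unit[OF FR this]
  have "\<forall>r\<in>F. unit_mate r \<in> F"
    using fE(4) se_E by (auto simp: F_def unit_mate_def)
  moreover have "net_outflow unit_tail unit_head F x = 0" if "x \<noteq> s" "x \<noteq> mate s" for x
  proof (cases "x \<in> V")
    case True
    then have "inflow E head f x = outflow E tail f x"
      using f that s_V by (simp add: is_IS_flow_def is_flow_def mate_def)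
    then show ?thesis using net[of x] by simp
  next
    case False
    have "unit_tail r \<in> V" "unit_head r \<in> V" if "r \<in> F" for r
      using that FR unit_ends_in_V by blast+
    with False show ?thesis unfolding net_outflow_def by (intro sum.neutral) auto
  qed
  ultimately have "unit.unit_flow s F" using FR by (simp add: unit.unit_flow_def)
  with net[of s] show thesis by (intro that[of F]) (simp_all add: flow_value_def)
qed

section \<open>Weak and strong duality\<close>

lemma odd_barrierD:
  assumes "odd_barrier V E tail head sv u s A Xs"
  shows "A \<subseteq> V" "s \<in> A" "A \<inter> sv ` A = {}"
    and "i < length Xs \<Longrightarrow> Xs ! i \<subseteq> V" "i < length Xs \<Longrightarrow> A \<inter> Xs ! i = {}"
    and "i < length Xs \<Longrightarrow> j < length Xs \<Longrightarrow> i \<noteq> j \<Longrightarrow> Xs ! i \<inter> Xs ! j = {}"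
    and "i < length Xs \<Longrightarrow> sv ` (Xs ! i) = Xs ! i"
    and "i < length Xs \<Longrightarrow> odd (cap_between E tail head u A (Xs ! i))"
    and "i < length Xs \<Longrightarrow> j < length Xs \<Longrightarrow> i \<noteq> j \<Longrightarrow> no_pos_arc E tail head u (Xs ! i) (Xs ! j)"
    and "i < length Xs \<Longrightarrow> no_pos_arc E tail head u (Xs ! i) (V - (A \<union> sv ` A \<union> \<Union>(set Xs)))"
  using assms unfolding odd_barrier_def Let_def by simp_all

text \<open>An odd capacity forces an odd number of residual arcs from \<open>A\<close> into each
  component, hence at least one. Components are disjoint, so these arcs are different.\<close>

lemma flow_value_le_barrier_capacity:
  assumes f: "is_IS_flow V E tail head sv se u s f" and bar: "odd_barrier V E tail head sv u s A Xs"
  shows "flow_value E tail head s f \<le> real_of_int (barrier_capacity V E tail head u A Xs)"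
proof -
  obtain F where F: "unit.unit_flow s F"
    and val: "flow_value E tail head s f = real_of_int (net_outflow unit_tail unit_head F s)"
    using unit_flow_of_IS_flow[OF f] by blast
  note D = odd_barrierD[OF bar]
  let ?t = "residual_tail unit_tail unit_head F" and ?h = "residual_head unit_tail unit_head F"
  let ?L = "{r \<in> unit_arcs. ?t r \<in> A \<and> ?h r \<notin> A}"
  let ?D = "\<lambda>i. {r \<in> unit_arcs. ?t r \<in> A \<and> ?h r \<in> Xs ! i}"
  have mateA: "mate x \<notin> A" if "x \<in> A" for x
    using that D(1,3) by (auto simp: mate_def)
  have "card (?D i) \<ge> 1" if i: "i < length Xs" for i
  proof -
    have "even (card (?D i)) \<longleftrightarrow>
        even (card {r \<in> unit_arcs. unit_tail r \<in> A \<and> unit_head r \<in> Xs ! i})"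
    proof (rule unit.residual_entering_parity[OF F _ _ _ mateA])
      show "finite (Xs ! i)" using D(4)[OF i] finite_V finite_subset by blast
      show "mate x \<in> Xs ! i \<and> mate x \<noteq> x" if "x \<in> Xs ! i" for x
        using that D(4)[OF i] D(7)[OF i] sv_V by (auto simp: mate_def)
      show "s \<notin> Xs ! i" "A \<inter> Xs ! i = {}" using D(2) D(5)[OF i] by auto
    next
      fix r assume r: "r \<in> unit_arcs" and tr: "unit_tail r \<in> Xs ! i"
      have a: "fst r \<in> E" "0 < u (fst r)" using r by (auto simp: unit_arcs_def)
      have hV: "unit_head r \<in> V" using unit_ends_in_V(2)[OF r] .
      show "unit_head r \<in> Xs ! i \<or> unit_head r \<in> A \<or> mate (unit_head r) \<in> A"
      proof (rule ccontr)
        \<comment> \<open>The head would lie in another component or outside all parts of the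
          barrier; both are excluded, since a unit arc comes from an arc of positive
          capacity.\<close>
        assume neg: "\<not> ?thesis"
        then have "unit_head r \<notin> sv ` A"
          using D(1) hV sv_V by (auto simp: mate_def)
        moreover have "unit_head r \<notin> V - (A \<union> sv ` A \<union> \<Union>(set Xs))"
          using D(10)[OF i] a tr by (auto simp: no_pos_arc_def unit_tail_def unit_head_def)
        ultimately obtain j where j: "j < length Xs" "unit_head r \<in> Xs ! j"
          using hV neg by (auto simp: in_set_conv_nth)
        moreover from this neg have "i \<noteq> j" by blast
        ultimately show False
          using D(9)[OF i, of j] a tr by (auto simp: no_pos_arc_def unit_tail_def unit_head_def)
      qed
    qed
    with D(8)[OF i] have "odd (card (?D i))" by (simp add: cap_between_eq_card)
    then show ?thesis by (cases "card (?D i)") auto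
  qed
  then have "length Xs \<le> (\<Sum>i<length Xs. card (?D i))"
    using sum_mono[of "{..<length Xs}" "\<lambda>_. 1::nat" "\<lambda>i. card (?D i)"] by simp
  also have "\<dots> = card (\<Union>i<length Xs. ?D i)"
    using unit.finite_arcs D(6) by (intro card_UN_disjoint[symmetric]) auto
  also have "\<dots> \<le> card ?L"
    using unit.finite_arcs D(5) by (intro card_mono) auto
  finally have "length Xs \<le> card ?L" .
  with barrier_capacity_eq[OF F D(1,2), of Xs] mateA[OF D(2)] s_V
  show ?thesis by (simp add: val mate_def)
qed

text \<open>Each residual arc leaving \<open>A\<close> yields one component, made of the vertices
  that it labels. It is the only residual arc from \<open>A\<close> into that component, so the
  capacity there is odd by the parity lemma.\<close>

lemma flow_attaining_barrier_capacity:
  "\<exists>f A Xs. is_IS_flow V E tail head sv se u s f \<and> odd_barrier V E tail head sv u s A Xs \<and>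
     flow_value E tail head s f = real_of_int (barrier_capacity V E tail head u A Xs)"
proof -
  have "mate s \<noteq> s" using s_V sv_V by (simp add: mate_def)
  from unit.unit_flow_residual_barrier[OF this] obtain F A0 l where F: "unit.unit_flow s F"
    and bar: "regular_barrier unit_arcs (residual_tail unit_tail unit_head F)
      (residual_head unit_tail unit_head F) mate {s} A0 l" by blast
  note D = regular_barrierD[OF bar]
  let ?t = "residual_tail unit_tail unit_head F" and ?h = "residual_head unit_tail unit_head F"
  define A where "A = A0 \<inter> V"
  define L where "L = {r \<in> unit_arcs. ?t r \<in> A \<and> ?h r \<notin> A}"
  define X where "X b = {x \<in> V. l x = Some b}" for b
  have "finite L" using unit.finite_arcs by (simp add: L_def)
  then obtain bs where bs: "set bs = L" "distinct bs" using finite_distinct_list by blast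
  define Xs where "Xs = map X bs"
  have AV: "A \<subseteq> V" and sA: "s \<in> A" using D(1) s_V by (auto simp: A_def)
  have mateV: "mate x \<in> V \<longleftrightarrow> x \<in> V" for x using sv_V by (simp add: mate_def)
  have mateA: "mate x \<notin> A" if "x \<in> A" for x using that D(2) by (simp add: A_def)
  have svA: "x \<in> sv ` A \<longleftrightarrow> mate x \<in> A" for x
  proof
    show "mate x \<in> A" if "x \<in> sv ` A" using that AV sv_V by (auto simp: mate_def)
    assume mx: "mate x \<in> A"
    then have "x \<in> V" using AV mateV by blast
    then have "x = sv (mate x)" using sv_V by (simp add: mate_def)
    with mx show "x \<in> sv ` A" by blast
  qed
  have resV: "?t r \<in> V" "?h r \<in> V" if "r \<in> unit_arcs" for r
    using that unit_ends_in_V by (simp_all add: residual_tail_def residual_head_def)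
  have XA: "x \<notin> A" "mate x \<notin> A" "x \<in> V" if "x \<in> X b" for x b
    using that D(3)[of x b] by (auto simp: X_def A_def)
  have X_mate: "mate x \<in> X b" if "x \<in> X b" for x b
    using that D(3)[of x b] mateV by (simp add: X_def)
  \<comment> \<open>Residual and original ends differ at most by an exchange, and equality of labels
    is symmetric in the ends.\<close>
  have same: "unit_tail r \<in> X b \<longleftrightarrow> unit_head r \<in> X b"
    if r: "r \<in> unit_arcs" and "unit_tail r \<notin> A" "mate (unit_tail r) \<notin> A"
      "unit_head r \<notin> A" "mate (unit_head r) \<notin> A" for r b
  proof -
    have "l (unit_tail r) = l (unit_head r)"
      using that D(5)[OF r] unit_ends_in_V[OF r] mateV
      by (cases "r \<in> F") (simp_all add: A_def residual_tail_def residual_head_def)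
    then show ?thesis using unit_ends_in_V[OF r] by (simp add: X_def)
  qed
  have entering: "{r \<in> unit_arcs. ?t r \<in> A \<and> ?h r \<in> X b} = {b}" if "b \<in> L" for b
  proof -
    have b: "b \<in> unit_arcs" "?t b \<in> A" "?h b \<notin> A" using that by (auto simp: L_def)
    then have "l (?h b) = Some b" using D(4)[OF b(1)] resV[OF b(1)] by (auto simp: A_def)
    then have "?h b \<in> X b" using resV[OF b(1)] by (simp add: X_def)
    moreover have "r = b" if r: "r \<in> unit_arcs" "?t r \<in> A" "?h r \<in> X b" for r
      using D(4)[OF r(1)] r(2,3) XA(1,3)[OF r(3)] by (auto simp: A_def X_def)
    ultimately show ?thesis using b by blast
  qed
  have odd: "odd (cap_between E tail head u A (X b))" if "b \<in> L" for b
  proof -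
    have "even (card {r \<in> unit_arcs. ?t r \<in> A \<and> ?h r \<in> X b}) \<longleftrightarrow>
        even (card {r \<in> unit_arcs. unit_tail r \<in> A \<and> unit_head r \<in> X b})"
    proof (rule unit.residual_entering_parity[OF F _ _ _ mateA])
      show "finite (X b)" using finite_V by (simp add: X_def)
      show "mate x \<in> X b \<and> mate x \<noteq> x" if "x \<in> X b" for x
        using X_mate[OF that] XA(3)[OF that] sv_V by (simp add: mate_def)
      show "s \<notin> X b" "A \<inter> X b = {}" using sA XA(1) by blast+
      show "unit_head r \<in> X b \<or> unit_head r \<in> A \<or> mate (unit_head r) \<in> A"
        if "r \<in> unit_arcs" "unit_tail r \<in> X b" for r
        using same[OF that(1)] XA[OF that(2)] that(2) by blast
    qed
    then show ?thesis by (simp add: entering[OF that] cap_between_eq_card)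
  qed
  \<comment> \<open>Covers arcs to other components and arcs to the rest of \<open>V\<close> at
    once; positive capacity is used through the unit copy \<open>(a, 0)\<close>.\<close>
  have no_arc: "no_pos_arc E tail head u (X b) Y"
    if Y: "\<And>y. y \<in> Y \<Longrightarrow> y \<notin> A \<and> mate y \<notin> A \<and> y \<notin> X b" for b Y
  proof -
    have "\<not> (tail a \<in> X b \<and> head a \<in> Y) \<and> \<not> (tail a \<in> Y \<and> head a \<in> X b)" if "a \<in> E" "0 < u a" for a
    proof -
      have "(a, 0) \<in> unit_arcs" using that by (simp add: unit_arcs_def)
      from same[OF this, of b] show ?thesis
        unfolding unit_tail_def unit_head_def fst_conv using Y XA(1,2)[where b = b] by blast
    qed
    then show ?thesis by (simp add: no_pos_arc_def)
  qed
  have XsL: "Xs ! i = X (bs ! i)" "bs ! i \<in> L" if "i < length Xs" for i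
    using that bs(1) by (auto simp: Xs_def)
  have XX: "X b \<inter> X c = {}" if "b \<noteq> c" for b c using that by (auto simp: X_def)
  have neq: "bs ! i \<noteq> bs ! j" if "i < length Xs" "j < length Xs" "i \<noteq> j" for i j
    using that bs(2) by (simp add: Xs_def nth_eq_iff_index_eq)
  have "odd_barrier V E tail head sv u s A Xs"
    unfolding odd_barrier_def Let_def
  proof (intro conjI allI impI)
    show "A \<subseteq> V" "s \<in> A" by (fact AV sA)+
    show "A \<inter> sv ` A = {}" using svA mateA by blast
    fix i assume i: "i < length Xs"
    show "Xs ! i \<subseteq> V" "A \<inter> Xs ! i = {}" using XA XsL[OF i] by blast+
    show "odd (cap_between E tail head u A (Xs ! i))" using odd XsL[OF i] by simp
    have X_sv: "sv x \<in> X b" if "x \<in> X b" for x b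
      using X_mate[OF that] XA(3)[OF that] by (simp add: mate_def)
    have "x \<in> sv ` X b" if "x \<in> X b" for x b
      using X_sv[OF that] XA(3)[OF that] sv_V(3)[of x] by (metis imageI)
    with X_sv show "sv ` (Xs ! i) = Xs ! i"
      unfolding XsL(1)[OF i] by blast
    show "no_pos_arc E tail head u (Xs ! i) (V - (A \<union> sv ` A \<union> \<Union>(set Xs)))"
      unfolding XsL(1)[OF i]
    proof (rule no_arc)
      fix y assume y: "y \<in> V - (A \<union> sv ` A \<union> \<Union>(set Xs))"
      have "X (bs ! i) \<in> set Xs" using XsL(1)[OF i] i nth_mem by metis
      with y svA show "y \<notin> A \<and> mate y \<notin> A \<and> y \<notin> X (bs ! i)" by blast
    qed
    fix j assume j: "j < length Xs" "i \<noteq> j"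
    show "Xs ! i \<inter> Xs ! j = {}" using XX neq[OF i j] XsL[OF i] XsL[OF j(1)] by simp
    show "no_pos_arc E tail head u (Xs ! i) (Xs ! j)"
      unfolding XsL(1)[OF i] XsL(1)[OF j(1)] using XX[OF neq[OF i j]] XA(1,2) by (intro no_arc) blast
  qed
  \<comment> \<open>One component per residual arc of the cut makes the gap between capacity and
    value vanish.\<close>
  moreover have "length Xs = card L"
    using bs by (simp add: Xs_def flip: distinct_card)
  then have "barrier_capacity V E tail head u A Xs = net_outflow unit_tail unit_head F s"
    using barrier_capacity_eq[OF F AV sA, of Xs] mateA[OF sA] s_V by (simp add: L_def mate_def)
  ultimately show ?thesis using IS_flow_of_unit_flow[OF F] by metis
qed

end

theorem mainTheorem6:
  fixes V :: "'v set" and E :: "'e set" and tail head :: "'e \<Rightarrow> 'v"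
    and sv :: "'v \<Rightarrow> 'v" and se :: "'e \<Rightarrow> 'e" and u :: "'e \<Rightarrow> nat" and s :: 'v
  assumes "skew_symmetric_network V E tail head sv se u s"
  shows "(\<exists>f A Xs. is_IS_flow V E tail head sv se u s f \<and> odd_barrier V E tail head sv u s A Xs \<and>
            flow_value E tail head s f = real_of_int (barrier_capacity V E tail head u A Xs)) \<and>
         (\<forall>f A Xs. is_IS_flow V E tail head sv se u s f \<and> odd_barrier V E tail head sv u s A Xs \<longrightarrow>
            flow_value E tail head s f \<le> real_of_int (barrier_capacity V E tail head u A Xs))"
proof -
  interpret skew_network V E tail head sv se u s by (rule skew_network.intro) (rule assms)
  show ?thesis using flow_attaining_barrier_capacity flow_value_le_barrier_capacity by blast
qed

end
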